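(* Let $n\ge 2$ and let $A$ be the $(n+1)\times(n+1)$ symmetric matrix associated with a summation-by-parts (SBP) second derivative operator $D_2=H^{-1}(-A-\mathbf{e}_L\mathbf{d}_L^{\mathsf T}+\mathbf{e}_R\mathbf{d}_R^{\mathsf T})$ on the grid $x_i=i/n$, $i=0,\dots,n$, fulfilling the consistency constraints $A\mathbf{1}=0$ and $A\mathbf{x}=\mathbf{e}_R-\mathbf{e}_L$. Let $\bar A$ be the $(n-1)\times(n-1)$ submatrix of $A$ obtained by deleting its first and last rows and columns. Then $$\operatorname{rank}(A)=n\quad\Longleftrightarrow\quad\operatorname{rank}(\bar A)=n-1.$$ That is, $A$ has exactly one zero eigenvalue (counted with multiplicity) if and only if $\bar A$ is invertible.
   Context: Grid and vectors: $h=1/n$, $x_i=ih$ for $i=0,1,\dots,n$; in $\mathbb{R}^{n+1}$, $\mathbf{1}=[1,1,\dots,1]^{\mathsf T}$, $\mathbf{x}=[x_0,x_1,\dots,x_n]^{\mathsf T}$, $\mathbf{e}_L=[1,0,\dots,0]^{\mathsf T}$, $\mathbf{e}_R=[0,\dots,0,1]^{\mathsf T}$. An SBP second derivative operator is a real $(n+1)\times(n+1)$ matrix $D_2=H^{-1}(-A-\mathbf{e}_L\mathbf{d}_L^{\mathsf T}+\mathbf{e}_R\mathbf{d}_R^{\mathsf T})$, where $H$ is symmetric positive definite, $A$ is symmetric positive semi-definite, and $\mathbf{d}_L,\mathbf{d}_R\in\mathbb{R}^{n+1}$ are consistent approximations of the first derivative at the left and right boundaries, i.e. $\mathbf{d}_L^{\mathsf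 T}\mathbf{1}=\mathbf{d}_R^{\mathsf T}\mathbf{1}=0$ and $\mathbf{d}_L^{\mathsf T}\mathbf{x}=\mathbf{d}_R^{\mathsf T}\mathbf{x}=1$. *)

theory Defs
  imports
    "Jordan_Normal_Form.DL_Rank"
    "Jordan_Normal_Form.Gauss_Jordan_Elimination"
    "Jordan_Normal_Form.Determinant"
    "Jordan_Normal_Form.Char_Poly"
begin

definition sym_pos_def :: "nat \<Rightarrow> real mat \<Rightarrow> bool" where
  "sym_pos_def m M \<longleftrightarrow> M \<in> carrier_mat m m \<and> transpose_mat M = M \<and>
     (\<forall>v \<in> carrier_vec m. v \<noteq> 0\<^sub>v m \<longrightarrow> v \<bullet> (M *\<^sub>v v) > 0)"

definition sym_pos_semidef :: "nat \<Rightarrow> real mat \<Rightarrow> bool" where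
  "sym_pos_semidef m M \<longleftrightarrow> M \<in> carrier_mat m m \<and> transpose_mat M = M \<and>
     (\<forall>v \<in> carrier_vec m. v \<bullet> (M *\<^sub>v v) \<ge> 0)"

text \<open>Vectors and matrices are indexed from 0, so grid index i = 0, ..., n is also the vector index
  in dimension n + 1.\<close>

definition ones_vec :: "nat \<Rightarrow> real vec" where
  "ones_vec n = vec (n + 1) (\<lambda>_. 1)"

definition grid_vec :: "nat \<Rightarrow> real vec" where
  "grid_vec n = vec (n + 1) (\<lambda>i. real i * (1 / real n))"

definition e_left :: "nat \<Rightarrow> real vec" where
  "e_left n = unit_vec (n + 1) 0"

definition e_right :: "nat \<Rightarrow> real vec" where
  "e_right n = unit_vec (n + 1) n"

text \<open>The matrix product of u, as a column, with v, as a row.\<close>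

definition outer_product :: "real vec \<Rightarrow> real vec \<Rightarrow> real mat" where
  "outer_product u v = transpose_mat (mat_of_row u) * mat_of_row v"

definition consistent_first_derivative :: "nat \<Rightarrow> real vec \<Rightarrow> bool" where
  "consistent_first_derivative n d \<longleftrightarrow>
     d \<in> carrier_vec (n + 1) \<and> d \<bullet> ones_vec n = 0 \<and> d \<bullet> grid_vec n = 1"

text \<open>The library function \<^const>\<open>mat_inverse\<close> is option-valued; it does not return \<^const>\<open>None\<close> here
  because a positive definite H is invertible (see \<open>sym_pos_def_mat_inverse\<close> below).\<close>

definition sbp_second_derivative ::
    "nat \<Rightarrow> real mat \<Rightarrow> real mat \<Rightarrow> real mat \<Rightarrow> real vec \<Rightarrow> real vec \<Rightarrow> bool" where
  "sbp_second_derivative n D\<^sub>2 H A d\<^sub>L d\<^sub>R \<longleftrightarrow>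
     sym_pos_def (n + 1) H \<and> sym_pos_semidef (n + 1) A \<and>
     consistent_first_derivative n d\<^sub>L \<and> consistent_first_derivative n d\<^sub>R \<and>
     D\<^sub>2 = the (mat_inverse H) *
            (- A - outer_product (e_left n) d\<^sub>L + outer_product (e_right n) d\<^sub>R)"

definition interior_submatrix :: "real mat \<Rightarrow> real mat" where
  "interior_submatrix M =
     mat_delete (mat_delete M (dim_row M - 1) (dim_col M - 1)) 0 0"

abbreviation mat_rank :: "real mat \<Rightarrow> nat" where
  "mat_rank M \<equiv> vec_space.rank (dim_row M) M"

lemma sym_pos_def_mat_inverse:
  assumes "sym_pos_def m H"
  shows "\<exists>K \<in> carrier_mat m m. mat_inverse H = Some K \<and> H * K = 1\<^sub>m m \<and> K * H = 1\<^sub>m m"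
proof -
  from assms have H: "H \<in> carrier_mat m m"
    and pos: "\<And>v. v \<in> carrier_vec m \<Longrightarrow> v \<noteq> 0\<^sub>v m \<Longrightarrow> v \<bullet> (H *\<^sub>v v) > 0"
    by (auto simp: sym_pos_def_def)
  have "det H \<noteq> 0"
  proof
    assume "det H = 0"
    then obtain v where "v \<in> carrier_vec m" "v \<noteq> 0\<^sub>v m" "H *\<^sub>v v = 0\<^sub>v m"
      using det_0_iff_vec_prod_zero[OF H] by auto
    with pos[of v] show False by simp
  qed
  then have U: "H \<in> Units (ring_mat TYPE(real) m ())"
    by (rule det_non_zero_imp_unit[OF H])
  then obtain K where K: "mat_inverse H = Some K"
    using mat_inverse(1)[OF H, where b = "()"] by (cases "mat_inverse H") auto
  show ?thesis
    using K mat_inverse(2)[OF H K] by auto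
qed

end

theory Submission
  imports Defs "Jordan_Normal_Form.Matrix_Kernel"
begin

text \<open>
  All four properties say that the kernel of A is spanned by the constant vector, or, after
  subtracting a constant, that the only kernel vector vanishing at the left end of the grid is 0.

  For the rank of A this is rank-nullity (\<open>rank_plus_kernel_dim\<close>, \<open>kernel_dim_eq_1_iff\<close>,
  \<open>const_kernel_iff\<close>).

  For the interior submatrix (\<open>det_interior_submatrix_iff\<close>) the reason is the identity
  \<open>x \<bullet> A v = A x \<bullet> v = v\<^sub>n - v\<^sub>0\<close>, which symmetry and the second constraint give for every v.
  If v is in the kernel of A and \<open>v\<^sub>0 = 0\<close>, it forces \<open>v\<^sub>n = 0\<close>, so v is determined by its interior
  part, which the interior submatrix annihilates. Conversely, let w be annihilated by the interior
  submatrix and let v be w padded with a zero at either end. Then A v can only be nonzero in its two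
  boundary entries; the identity above makes the right one vanish, and
  \<open>1 \<bullet> A v = A 1 \<bullet> v = 0\<close> then makes the left one vanish, so v is in the kernel of A.

  For the algebraic multiplicity (\<open>order_0_char_poly_eq_1_iff\<close>), a change of basis that makes the
  constant vector the first basis vector turns A into a block triangular matrix with zero first
  column, so one factor X splits off the characteristic polynomial. What remains is the
  characteristic polynomial of a block B, and B is injective precisely when the kernel of A is as
  above: symmetry gives \<open>1 \<bullet> A v = 0\<close>, so A v cannot be a nonzero constant, which is what rules out a
  nontrivial Jordan block at 0.
\<close>

section \<open>Rank, kernel and invertibility\<close>

text \<open>Rank-nullity for the linear map \<open>v \<mapsto> A v\<close>: its image is the column space, whose dimension is
  the rank by definition.\<close>

lemma rank_plus_kernel_dim:
  fixes A :: "'a::field mat"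
  assumes A: "A \<in> carrier_mat nr nc"
  shows "vec_space.rank nr A + kernel_dim A = nc"
proof -
  interpret K: kernel nr nc A by unfold_locales (rule A)
  interpret R: vec_space "TYPE('a)" nr .
  interpret L: linear_map class_ring "module_vec TYPE('a) nc" "module_vec TYPE('a) nr" "\<lambda>v. A *\<^sub>v v"
  proof (intro linear_map.intro mod_hom.intro mod_hom_axioms.intro vec_vs)
    show "Module.module class_ring (module_vec TYPE('a) nc)" "Module.module class_ring (module_vec TYPE('a) nr)"
      by (rule vec_module)+
    show "(\<lambda>v. A *\<^sub>v v) \<in> LinearCombinations.module_hom class_ring (module_vec TYPE('a) nc) (module_vec TYPE('a) nr)"
      using A by (auto simp: LinearCombinations.module_hom_def module_vec_simps
          mult_add_distrib_mat_vec[of _ nr nc] mult_mat_vec[of _ nr nc])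
  qed
  have im: "L.im = R.span (set (cols A))"
    using A unfolding L.im_def R.col_space_def[symmetric] R.col_space_eq[OF A]
    by (auto simp: module_vec_simps)
  have ker: "L.ker = mat_kernel A"
    using A unfolding L.ker_def mat_kernel[OF A] by (auto simp: module_vec_simps)
  show ?thesis
    using L.rank_nullity[OF K.NC.fin_dim] K.NC.dim_is_n
    unfolding im ker R.rank_def K.kernel_dim by simp
qed

lemma kernel_dim_eq_1_iff:
  fixes A :: "'a::field mat"
  assumes A: "A \<in> carrier_mat nr nc" and u: "u \<in> mat_kernel A" "u \<noteq> 0\<^sub>v nc"
  shows "kernel_dim A = 1 \<longleftrightarrow> (\<forall>v\<in>mat_kernel A. \<exists>c. v = c \<cdot>\<^sub>v u)"
proof -
  interpret K: kernel nr nc A by unfold_locales (rule A)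
  have u_nc: "u \<in> carrier_vec nc" using mat_kernelD[OF A u(1)] by simp
  have lincomb_u: "K.lincomb a {u} = a u \<cdot>\<^sub>v u" for a
  proof -
    have "K.lincomb a {u} = K.NC.lincomb a {u}" using u(1) by (intro K.lincomb_same) simp
    also have "\<dots> = a u \<cdot>\<^sub>v u" using u_nc by (simp add: K.NC.lincomb_def)
    finally show ?thesis .
  qed
  \<comment> \<open>A nonzero entry of u recovers the coefficient from any multiple of u.\<close>
  obtain i where i: "i < nc" "u $ i \<noteq> 0"
    using u(2) u_nc by (metis carrier_vecD eq_vecI index_zero_vec)
  have indpt: "\<not> K.lin_dep {u}"
  proof (rule K.Ker.finite_lin_indpt2)
    show "\<forall>v\<in>{u}. a v = 0" if "K.lincomb a {u} = 0\<^sub>v nc" for a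
    proof -
      have "(a u \<cdot>\<^sub>v u) $ i = 0" using that i unfolding lincomb_u by simp
      then show ?thesis using i u_nc by simp
    qed
  qed (use u in auto)
  have span_u: "K.span {u} = range (\<lambda>c. c \<cdot>\<^sub>v u)"
    using K.Ker.finite_span[of "{u}"] u(1) lincomb_u by (auto intro: exI[of _ "\<lambda>_. _"])
  have fin_dim: "K.Ker.fin_dim"
    using kernel_basis_exists[OF A] by (auto simp: K.Ker.fin_dim_def K.Ker.basis_def)
  show ?thesis
  proof
    assume "kernel_dim A = 1"
    then have "K.basis {u}"
      using K.Ker.dim_li_is_basis[of "{u}"] fin_dim K.kernel_dim indpt u(1) by simp
    then show "\<forall>v\<in>mat_kernel A. \<exists>c. v = c \<cdot>\<^sub>v u"
      using span_u by (auto simp: K.Ker.basis_def)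
  next
    assume "\<forall>v\<in>mat_kernel A. \<exists>c. v = c \<cdot>\<^sub>v u"
    then have "K.span {u} = mat_kernel A"
      unfolding span_u using mat_kernel_smult[OF A u(1)] by auto
    then have "K.basis {u}" using indpt u(1) by (simp add: K.Ker.basis_def)
    then show "kernel_dim A = 1" using K.Ker.dim_basis[of "{u}"] K.kernel_dim by simp
  qed
qed

lemma invertible_mat_iff_det:
  fixes A :: "'a::field mat"
  assumes A: "A \<in> carrier_mat n n"
  shows "invertible_mat A \<longleftrightarrow> det A \<noteq> 0"
proof
  assume "invertible_mat A"
  then obtain B where "A * B = 1\<^sub>m n" "B * A = 1\<^sub>m (dim_row B)"
    using A unfolding invertible_mat_def inverts_mat_def by auto
  moreover from this have "B \<in> carrier_mat n n"
    using A by (metis carrier_mat_triv index_mult_mat(2,3) index_one_mat(2,3) carrier_matD)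
  ultimately have "det A * det B = 1" using A det_mult[of A n B] by simp
  then show "det A \<noteq> 0" by auto
next
  assume "det A \<noteq> 0"
  then obtain B where "B \<in> carrier_mat n n" "A * B = 1\<^sub>m n" "B * A = 1\<^sub>m n"
    using det_non_zero_imp_unit[OF A, of "()"] by (auto simp: Units_def ring_mat_def)
  then show "invertible_mat A"
    using A unfolding invertible_mat_def inverts_mat_def by auto
qed

section \<open>Splitting off a zero eigenvalue\<close>

lemma uminus_mult_eq:
  fixes A B C :: "'a::comm_ring_1 mat"
  assumes C: "C \<in> carrier_mat n k" and A: "A \<in> carrier_mat n m" and B: "B \<in> carrier_mat m k"
    and sum: "C + A * B = 0\<^sub>m n k"
  shows "A * - B = C"
proof (rule eq_matI)
  fix i j assume ij: "i < dim_row C" "j < dim_col C"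
  have "(C + A * B) $$ (i, j) = 0" using ij C sum by simp
  then show "(A * - B) $$ (i, j) = C $$ (i, j)"
    using ij A B C by (simp add: add_eq_0_iff)
qed (use A B C in auto)

text \<open>The hypotheses say that the vector \<open>(1, U)\<close> is in the kernel of the block matrix. Taking it as
  the first basis vector and keeping the other unit vectors is a similarity after which the first
  column is zero.\<close>

lemma char_poly_zero_row_sums:
  fixes a r c D :: "'a::comm_ring_1 mat"
  assumes carr: "a \<in> carrier_mat 1 1" "r \<in> carrier_mat 1 m" "c \<in> carrier_mat m 1" "D \<in> carrier_mat m m"
    and U: "U \<in> carrier_mat m 1"
    and ker: "a + r * U = 0\<^sub>m 1 1" "c + D * U = 0\<^sub>m m 1"
  shows "char_poly (four_block_mat a r c D) = char_poly (0\<^sub>m 1 1) * char_poly (D - U * r)"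
proof -
  \<comment> \<open>P replaces the first unit vector by \<open>(1, U)\<close>; Q is its inverse.\<close>
  let ?P = "four_block_mat (1\<^sub>m 1) (0\<^sub>m 1 m) U (1\<^sub>m m)"
  let ?Q = "four_block_mat (1\<^sub>m 1) (0\<^sub>m 1 m) (- U) (1\<^sub>m m)"
  let ?M = "four_block_mat (0\<^sub>m 1 1) r (0\<^sub>m m 1) (D - U * r)"
  have [simp]: "- 0\<^sub>m k l = (0\<^sub>m k l :: 'a mat)" for k l by (rule eq_matI) auto
  have "?P * ?Q = four_block_mat (1\<^sub>m 1) (0\<^sub>m 1 m) (0\<^sub>m m 1) (1\<^sub>m m)"
    "?Q * ?P = four_block_mat (1\<^sub>m 1) (0\<^sub>m 1 m) (0\<^sub>m m 1) (1\<^sub>m m)"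
    using U by (subst mult_four_block_mat[of _ 1 1 _ m _ m _ _ 1 _ m];
        auto simp: add_uminus_minus_mat)+
  moreover have "four_block_mat a r c D = ?P * ?M * ?Q"
  proof -
    have "?P * ?M = four_block_mat (0\<^sub>m 1 1) r (0\<^sub>m m 1) D"
      using carr U by (subst mult_four_block_mat[of _ 1 1 _ m _ m _ _ 1 _ m]) auto
    also have "\<dots> * ?Q = four_block_mat (r * - U) r (D * - U) D"
      using carr U by (subst mult_four_block_mat[of _ 1 1 _ m _ m _ _ 1 _ m]) auto
    also have "r * - U = a"
      using carr(1,2) U ker(1) by (rule uminus_mult_eq)
    also have "D * - U = c"
      using carr(3,4) U ker(2) by (rule uminus_mult_eq)
    finally show ?thesis by simp
  qed
  ultimately have "similar_mat (four_block_mat a r c D) ?M"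
    using carr U by (intro similar_matI[of _ _ _ _ "1 + m"]) auto
  then have "char_poly (four_block_mat a r c D) = char_poly ?M"
    by (rule char_poly_similar)
  also have "\<dots> = char_poly (0\<^sub>m 1 1) * char_poly (D - U * r)"
    using carr U by (intro char_poly_four_block_zeros_col) auto
  finally show ?thesis .
qed

section \<open>Symmetric matrices annihilating the constants\<close>

text \<open>Places w at the grid indices \<open>1, ..., dim_vec w\<close> and puts 0 elsewhere. Taking \<open>dim_vec w = n - 1\<close>
  pads an interior vector at both ends, and \<open>dim_vec w = n\<close> pads at the left end only; the two cases
  serve the interior submatrix and the block of the similarity above.\<close>

definition shift_pad :: "nat \<Rightarrow> real vec \<Rightarrow> real vec" where
  "shift_pad n w = vec (n + 1) (\<lambda>i. if 0 < i \<and> i \<le> dim_vec w then w $ (i - 1) else 0)"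

lemma shift_pad_carrier [simp]: "shift_pad n w \<in> carrier_vec (n + 1)"
  by (simp add: shift_pad_def)

lemma shift_pad_eq_0_iff:
  assumes w: "w \<in> carrier_vec m" "m \<le> n"
  shows "shift_pad n w = 0\<^sub>v (n + 1) \<longleftrightarrow> w = 0\<^sub>v m"
proof
  assume *: "shift_pad n w = 0\<^sub>v (n + 1)"
  show "w = 0\<^sub>v m"
  proof (rule eq_vecI)
    fix i assume "i < dim_vec (0\<^sub>v m)"
    then have "w $ i = shift_pad n w $ Suc i" using w by (simp add: shift_pad_def)
    then show "w $ i = 0\<^sub>v m $ i" using * w \<open>i < dim_vec (0\<^sub>v m)\<close> by simp
  qed (use w in simp)
next
  assume "w = 0\<^sub>v m"
  then show "shift_pad n w = 0\<^sub>v (n + 1)" by (intro eq_vecI) (auto simp: shift_pad_def)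
qed

lemma mult_mat_vec_shift_pad:
  assumes A: "A \<in> carrier_mat k (n + 1)" and w: "w \<in> carrier_vec m" "m \<le> n" and i: "i < k"
  shows "(A *\<^sub>v shift_pad n w) $ i = (\<Sum>j<m. A $$ (i, Suc j) * w $ j)"
proof -
  have "(A *\<^sub>v shift_pad n w) $ i = (\<Sum>j<Suc n. A $$ (i, j) * shift_pad n w $ j)"
    using A i by (simp add: scalar_prod_def shift_pad_def atLeast0LessThan)
  also have "\<dots> = (\<Sum>j<n. A $$ (i, Suc j) * shift_pad n w $ Suc j)"
    by (subst sum.lessThan_Suc_shift) (simp add: shift_pad_def)
  also have "\<dots> = (\<Sum>j<n. if j < m then A $$ (i, Suc j) * w $ j else 0)"
    using w by (intro sum.cong) (auto simp: shift_pad_def)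
  also have "\<dots> = (\<Sum>j<m. A $$ (i, Suc j) * w $ j)"
    using w by (subst sum.inter_filter[symmetric]) (auto intro!: sum.cong)
  finally show ?thesis .
qed

text \<open>Subtracting its value at the left end from a kernel vector stays in the kernel, so it suffices to
  look at kernel vectors that vanish there.\<close>

lemma const_kernel_iff:
  assumes A: "A \<in> carrier_mat k (n + 1)" and A1: "A *\<^sub>v ones_vec n = 0\<^sub>v k"
  shows "(\<forall>v\<in>mat_kernel A. \<exists>c. v = c \<cdot>\<^sub>v ones_vec n) \<longleftrightarrow>
         (\<forall>v\<in>mat_kernel A. v $ 0 = 0 \<longrightarrow> v = 0\<^sub>v (n + 1))" (is "?L \<longleftrightarrow> ?R")
proof
  assume ?L
  then show ?R by (force simp: ones_vec_def)
next
  assume R: ?R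
  show ?L
  proof
    fix v assume v: "v \<in> mat_kernel A"
    note v' = mat_kernelD[OF A v]
    have one: "ones_vec n \<in> carrier_vec (n + 1)" by (simp add: ones_vec_def)
    let ?u = "v - v $ 0 \<cdot>\<^sub>v ones_vec n"
    have "A *\<^sub>v ?u = A *\<^sub>v v - v $ 0 \<cdot>\<^sub>v (A *\<^sub>v ones_vec n)"
      using A v' one by (simp add: mult_minus_distrib_mat_vec mult_mat_vec)
    then have "?u \<in> mat_kernel A"
      using v' one A1 by (intro mat_kernelI[OF A]) auto
    moreover have "?u $ 0 = 0" using v' by (simp add: ones_vec_def)
    ultimately have u: "?u = 0\<^sub>v (n + 1)" using R by blast
    have "v = v $ 0 \<cdot>\<^sub>v ones_vec n"
    proof (rule eq_vecI)
      fix i assume "i < dim_vec (v $ 0 \<cdot>\<^sub>v ones_vec n)"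
      then have i: "i < n + 1" by (simp add: ones_vec_def)
      have "?u $ i = 0" using u i by simp
      then show "v $ i = (v $ 0 \<cdot>\<^sub>v ones_vec n) $ i" using i v' one by simp
    qed (use v' one in simp)
    then show "\<exists>c. v = c \<cdot>\<^sub>v ones_vec n" ..
  qed
qed

lemma symmetric_scalar_prod:
  fixes A :: "'a::comm_semiring_0 mat"
  assumes A: "A \<in> carrier_mat n n" "transpose_mat A = A"
    and v: "v \<in> carrier_vec n" and u: "u \<in> carrier_vec n"
  shows "u \<bullet> (A *\<^sub>v v) = (A *\<^sub>v u) \<bullet> v"
  using transpose_vec_mult_scalar[OF A(1) v u] A(2) by simp

lemma scalar_prod_ones_vec_symmetric:
  assumes A: "A \<in> carrier_mat (n + 1) (n + 1)" "transpose_mat A = A"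
    and A1: "A *\<^sub>v ones_vec n = 0\<^sub>v (n + 1)" and v: "v \<in> carrier_vec (n + 1)"
  shows "ones_vec n \<bullet> (A *\<^sub>v v) = 0"
proof -
  have "ones_vec n \<in> carrier_vec (n + 1)" by (simp add: ones_vec_def)
  from symmetric_scalar_prod[OF A v this] show ?thesis using v unfolding A1 by simp
qed

text \<open>The complementary block B acts on w by \<open>(B w)\<^sub>i = (A v)\<^bsub>i+1\<^esub> - (A v)\<^sub>0\<close>, where v is w with a zero
  prepended. Hence \<open>B w = 0\<close> means that A v is constant; since A v is orthogonal to the constants,
  it is then 0.\<close>

lemma order_0_char_poly_eq_1_iff:
  assumes A: "A \<in> carrier_mat (n + 1) (n + 1)" and sym: "transpose_mat A = A"
    and A1: "A *\<^sub>v ones_vec n = 0\<^sub>v (n + 1)"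
  shows "Polynomial.order 0 (char_poly A) = 1 \<longleftrightarrow>
         (\<forall>v\<in>mat_kernel A. v $ 0 = 0 \<longrightarrow> v = 0\<^sub>v (n + 1))"
proof -
  define a where "a = mat 1 1 (\<lambda>_. A $$ (0, 0))"
  define r where "r = mat 1 n (\<lambda>(_, j). A $$ (0, Suc j))"
  define c where "c = mat n 1 (\<lambda>(i, _). A $$ (Suc i, 0))"
  define D where "D = mat n n (\<lambda>(i, j). A $$ (Suc i, Suc j))"
  define U where "U = mat n 1 (\<lambda>_. 1 :: real)"
  note defs = a_def r_def c_def D_def U_def
  let ?B = "D - U * r"
  have "U * r \<in> carrier_mat n n" by (rule mult_carrier_mat[of _ _ 1]) (simp_all add: defs)
  then have B: "?B \<in> carrier_mat n n" by (rule minus_carrier_mat)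
  have row_sum: "A $$ (i, 0) + (\<Sum>j<n. A $$ (i, Suc j)) = 0" if "i < n + 1" for i
  proof -
    have "0 = (\<Sum>j<Suc n. A $$ (i, j))"
      using arg_cong[OF A1, of "\<lambda>v. v $ i"] that A
      by (simp add: scalar_prod_def ones_vec_def atLeast0LessThan)
    then show ?thesis by (subst (asm) sum.lessThan_Suc_shift) simp
  qed
  have "A = four_block_mat a r c D"
    by (rule eq_matI) (use A in \<open>auto simp: defs\<close>)
  also have "char_poly \<dots> = char_poly (0\<^sub>m 1 1) * char_poly ?B"
  proof (rule char_poly_zero_row_sums)
    show "a + r * U = 0\<^sub>m 1 1"
      by (rule eq_matI) (use row_sum[of 0] in \<open>auto simp: defs scalar_prod_def atLeast0LessThan\<close>)
    show "c + D * U = 0\<^sub>m n 1"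
      by (rule eq_matI) (use row_sum in \<open>auto simp: defs scalar_prod_def atLeast0LessThan\<close>)
  qed (auto simp: defs)
  also have "char_poly (0\<^sub>m 1 1 :: real mat) = [:0, 1:]"
    by (simp add: char_poly_defs det_single)
  finally have cp: "char_poly A = [:0, 1:] * char_poly ?B" .
  have zero_smult: "0 \<cdot>\<^sub>v w = 0\<^sub>v n" if "w \<in> carrier_vec n" for w :: "real vec"
    using that by (intro eq_vecI) auto
  have nz: "char_poly ?B \<noteq> 0" using degree_monic_char_poly[OF B] by auto
  have "Polynomial.order 0 (char_poly A) = 1 + Polynomial.order 0 (char_poly ?B)"
    unfolding cp using nz order_power_n_n[of 0 1] by (subst order_mult) auto
  then have "Polynomial.order 0 (char_poly A) = 1 \<longleftrightarrow> \<not> eigenvalue ?B 0"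
    using nz by (simp add: order_root eigenvalue_root_char_poly[OF B])
  also have "\<dots> \<longleftrightarrow> (\<forall>w\<in>carrier_vec n. ?B *\<^sub>v w = 0\<^sub>v n \<longrightarrow> w = 0\<^sub>v n)"
    using zero_smult by (auto simp: eigenvalue_def eigenvector_def U_def)
  also have "\<dots> \<longleftrightarrow> (\<forall>v\<in>mat_kernel A. v $ 0 = 0 \<longrightarrow> v = 0\<^sub>v (n + 1))"
  proof -
    have B_mult: "(?B *\<^sub>v w) $ i = (A *\<^sub>v shift_pad n w) $ Suc i - (A *\<^sub>v shift_pad n w) $ 0"
      if "w \<in> carrier_vec n" "i < n" for w i
    proof -
      have "(?B *\<^sub>v w) $ i = (\<Sum>j<n. (A $$ (Suc i, Suc j) - A $$ (0, Suc j)) * w $ j)"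
        using that by (simp add: defs scalar_prod_def atLeast0LessThan)
      then show ?thesis
        using that mult_mat_vec_shift_pad[OF A that(1) order.refl, of "Suc i"]
          mult_mat_vec_shift_pad[OF A that(1) order.refl, of 0]
        by (simp only: left_diff_distrib sum_subtractf)
    qed
    have ker: "shift_pad n w \<in> mat_kernel A" if w: "w \<in> carrier_vec n" "?B *\<^sub>v w = 0\<^sub>v n" for w
    proof -
      let ?y = "A *\<^sub>v shift_pad n w"
      have const: "?y $ i = ?y $ 0" if "i < n + 1" for i
        using B_mult[OF w(1), of "i - 1"] w(2) that by (cases i) auto
      have "ones_vec n \<bullet> ?y = 0"
        by (rule scalar_prod_ones_vec_symmetric[OF A sym A1 shift_pad_carrier])
      also have "ones_vec n \<bullet> ?y = real (n + 1) * ?y $ 0"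
      proof -
        have "ones_vec n \<bullet> ?y = (\<Sum>i<n + 1. ?y $ i)"
          using A by (simp add: scalar_prod_def ones_vec_def atLeast0LessThan)
        also have "\<dots> = (\<Sum>i<n + 1. ?y $ 0)"
          by (rule sum.cong) (use const in blast)+
        finally show ?thesis by simp
      qed
      finally have "?y $ 0 = 0" by simp
      then have "?y $ i = 0" if "i < n + 1" for i
        using const[OF that] by simp
      then have "?y = 0\<^sub>v (n + 1)"
        by (intro eq_vecI) (use A in \<open>simp_all del: index_mult_mat_vec\<close>)
      then show ?thesis by (rule mat_kernelI[OF A shift_pad_carrier])
    qed
    show ?thesis
    proof (intro iffI ballI impI)
      fix v assume *: "\<forall>w\<in>carrier_vec n. ?B *\<^sub>v w = 0\<^sub>v n \<longrightarrow> w = 0\<^sub>v n"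
        and v: "v \<in> mat_kernel A" "v $ 0 = 0"
      define w where "w = vec n (\<lambda>i. v $ Suc i)"
      have w: "w \<in> carrier_vec n" by (simp add: w_def)
      have v_eq: "v = shift_pad n w"
        by (rule eq_vecI) (use v mat_kernelD[OF A v(1)] in \<open>auto simp: shift_pad_def w_def\<close>)
      have "?B *\<^sub>v w = 0\<^sub>v n"
        by (rule eq_vecI)
          (use B w B_mult[OF w] mat_kernelD[OF A v(1)] in \<open>auto simp: v_eq[symmetric]\<close>)
      then show "v = 0\<^sub>v (n + 1)"
        using * w shift_pad_eq_0_iff[OF w order.refl] v_eq by auto
    next
      fix w assume *: "\<forall>v\<in>mat_kernel A. v $ 0 = 0 \<longrightarrow> v = 0\<^sub>v (n + 1)"
        and w: "w \<in> carrier_vec n" "?B *\<^sub>v w = 0\<^sub>v n"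
      have "shift_pad n w = 0\<^sub>v (n + 1)"
        using * ker[OF w] by (auto simp: shift_pad_def)
      then show "w = 0\<^sub>v n" using shift_pad_eq_0_iff[OF w(1) order.refl] by simp
    qed
  qed
  finally show ?thesis .
qed

section \<open>The interior submatrix\<close>

lemma interior_submatrix_carrier:
  "A \<in> carrier_mat (n + 1) (n + 1) \<Longrightarrow> interior_submatrix A \<in> carrier_mat (n - 1) (n - 1)"
  by (intro carrier_matI) (simp_all add: interior_submatrix_def)

lemma interior_submatrix_index:
  assumes "A \<in> carrier_mat (n + 1) (n + 1)" "i < n - 1" "j < n - 1"
  shows "interior_submatrix A $$ (i, j) = A $$ (Suc i, Suc j)"
proof -
  have "Suc i < n" "Suc j < n" using assms(2,3) by auto
  then show ?thesis using assms by (simp add: interior_submatrix_def mat_delete_def)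
qed

lemma interior_submatrix_mult_vec:
  assumes A: "A \<in> carrier_mat (n + 1) (n + 1)" and w: "w \<in> carrier_vec (n - 1)" and i: "i < n - 1"
  shows "(interior_submatrix A *\<^sub>v w) $ i = (A *\<^sub>v shift_pad n w) $ Suc i"
proof -
  have "Suc i < n + 1" using i by simp
  then show ?thesis
    using i w interior_submatrix_carrier[OF A]
    by (subst mult_mat_vec_shift_pad[OF A w])
      (auto simp: scalar_prod_def atLeast0LessThan interior_submatrix_index[OF A] intro!: sum.cong)
qed

text \<open>The two constraints control exactly the two boundary entries of A v: pairing with the grid vector
  isolates the right one, pairing with the constants gives the sum of both.\<close>

lemma det_interior_submatrix_iff:
  assumes n: "n \<ge> 1" and A: "A \<in> carrier_mat (n + 1) (n + 1)" and sym: "transpose_mat A = A"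
    and A1: "A *\<^sub>v ones_vec n = 0\<^sub>v (n + 1)"
    and Ax: "A *\<^sub>v grid_vec n = e_right n - e_left n"
  shows "(\<forall>v\<in>mat_kernel A. v $ 0 = 0 \<longrightarrow> v = 0\<^sub>v (n + 1)) \<longleftrightarrow> det (interior_submatrix A) \<noteq> 0"
proof -
  let ?I = "interior_submatrix A"
  have I: "?I \<in> carrier_mat (n - 1) (n - 1)" by (rule interior_submatrix_carrier[OF A])
  \<comment> \<open>Summation by parts: \<open>x \<bullet> A v = A x \<bullet> v\<close> sees only the boundary values of v.\<close>
  have grid: "grid_vec n \<bullet> (A *\<^sub>v v) = v $ n - v $ 0" if v: "v \<in> carrier_vec (n + 1)" for v
  proof -
    have "grid_vec n \<bullet> (A *\<^sub>v v) = (e_right n - e_left n) \<bullet> v"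
      using v by (subst symmetric_scalar_prod[OF A sym]) (simp_all add: Ax, simp add: grid_vec_def)
    also have "\<dots> = v $ n - v $ 0"
      using v by (subst minus_scalar_prod_distrib[of _ "n + 1"]) (auto simp: e_right_def e_left_def)
    finally show ?thesis .
  qed
  have ker: "shift_pad n w \<in> mat_kernel A" if w: "w \<in> carrier_vec (n - 1)" "?I *\<^sub>v w = 0\<^sub>v (n - 1)" for w
  proof -
    let ?y = "A *\<^sub>v shift_pad n w"
    have interior: "?y $ i = 0" if "0 < i" "i < n" for i
      using interior_submatrix_mult_vec[OF A w(1), of "i - 1"] w(2) that by auto
    have boundary: "(\<Sum>i<n + 1. f i * ?y $ i) = f 0 * ?y $ 0 + f n * ?y $ n" for f :: "nat \<Rightarrow> real"
    proof -
      have "(\<Sum>i<n + 1. f i * ?y $ i) = (\<Sum>i\<in>{0, n}. f i * ?y $ i)"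
        by (rule sum.mono_neutral_right) (auto simp: interior)
      then show ?thesis using n by simp
    qed
    have "grid_vec n \<bullet> ?y = 0"
      using n w(1) by (subst grid) (auto simp: shift_pad_def)
    moreover have "grid_vec n \<bullet> ?y = ?y $ n"
      using A n boundary[of "\<lambda>i. real i * (1 / real n)"]
      by (simp add: scalar_prod_def grid_vec_def atLeast0LessThan)
    ultimately have yn: "?y $ n = 0" by simp
    have "ones_vec n \<bullet> ?y = 0"
      by (rule scalar_prod_ones_vec_symmetric[OF A sym A1 shift_pad_carrier])
    moreover have "ones_vec n \<bullet> ?y = ?y $ 0 + ?y $ n"
      using A boundary[of "\<lambda>_. 1"]
      by (simp add: scalar_prod_def ones_vec_def atLeast0LessThan)
    ultimately have y0: "?y $ 0 = 0" using yn by simp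
    have "?y = 0\<^sub>v (n + 1)"
    proof (rule eq_vecI)
      fix i assume "i < dim_vec (0\<^sub>v (n + 1))"
      then consider "i = 0" | "i = n" | "0 < i" "i < n" by fastforce
      then show "?y $ i = 0\<^sub>v (n + 1) $ i" using y0 yn interior by cases auto
    qed (use A in simp)
    then show ?thesis by (rule mat_kernelI[OF A shift_pad_carrier])
  qed
  have "(\<forall>v\<in>mat_kernel A. v $ 0 = 0 \<longrightarrow> v = 0\<^sub>v (n + 1)) \<longleftrightarrow>
    (\<forall>w\<in>carrier_vec (n - 1). ?I *\<^sub>v w = 0\<^sub>v (n - 1) \<longrightarrow> w = 0\<^sub>v (n - 1))"
  proof (intro iffI ballI impI)
    fix v assume *: "\<forall>w\<in>carrier_vec (n - 1). ?I *\<^sub>v w = 0\<^sub>v (n - 1) \<longrightarrow> w = 0\<^sub>v (n - 1)"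
      and v: "v \<in> mat_kernel A" "v $ 0 = 0"
    note v' = mat_kernelD[OF A v(1)]
    have "grid_vec n \<bullet> 0\<^sub>v (n + 1) = 0" by (simp add: grid_vec_def scalar_prod_def)
    then have vn: "v $ n = 0" using grid[OF v'(1)] v(2) unfolding v'(2) by linarith
    define w where "w = vec (n - 1) (\<lambda>i. v $ Suc i)"
    have w: "w \<in> carrier_vec (n - 1)" by (simp add: w_def)
    have v_eq: "v = shift_pad n w"
    proof (rule eq_vecI)
      fix i assume "i < dim_vec (shift_pad n w)"
      then consider "i = 0" | "i = n" | "0 < i" "i < n" by (fastforce simp: shift_pad_def)
      then show "v $ i = shift_pad n w $ i" using n v vn by cases (auto simp: shift_pad_def w_def)
    qed (use v' in \<open>simp add: shift_pad_def\<close>)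
    have "?I *\<^sub>v w = 0\<^sub>v (n - 1)"
      by (rule eq_vecI)
        (use I w interior_submatrix_mult_vec[OF A w] v' in \<open>auto simp: v_eq[symmetric] simp del: index_mult_mat_vec\<close>)
    then show "v = 0\<^sub>v (n + 1)"
      using * w shift_pad_eq_0_iff[OF w, of n] v_eq by auto
  next
    fix w assume *: "\<forall>v\<in>mat_kernel A. v $ 0 = 0 \<longrightarrow> v = 0\<^sub>v (n + 1)"
      and w: "w \<in> carrier_vec (n - 1)" "?I *\<^sub>v w = 0\<^sub>v (n - 1)"
    have "shift_pad n w = 0\<^sub>v (n + 1)"
      using * ker[OF w] by (auto simp: shift_pad_def)
    then show "w = 0\<^sub>v (n - 1)" using shift_pad_eq_0_iff[OF w(1)] by simp
  qed
  also have "\<dots> \<longleftrightarrow> det ?I \<noteq> 0"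
    unfolding det_0_iff_vec_prod_zero[OF I] by auto
  finally show ?thesis .
qed

theorem corollary4p2:
  fixes n :: nat and D\<^sub>2 H A :: "real mat" and d\<^sub>L d\<^sub>R :: "real vec"
  assumes "n \<ge> 2"
    and "sbp_second_derivative n D\<^sub>2 H A d\<^sub>L d\<^sub>R"
    and "A *\<^sub>v ones_vec n = 0\<^sub>v (n + 1)"
    and "A *\<^sub>v grid_vec n = e_right n - e_left n"
  shows "(mat_rank A = n \<longleftrightarrow> mat_rank (interior_submatrix A) = n - 1) \<and>
         (Polynomial.order 0 (char_poly A) = 1 \<longleftrightarrow> invertible_mat (interior_submatrix A))"
proof -
  have A: "A \<in> carrier_mat (n + 1) (n + 1)" and sym: "transpose_mat A = A"
    using assms(2) by (auto simp: sbp_second_derivative_def sym_pos_semidef_def)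
  let ?I = "interior_submatrix A"
  have I: "?I \<in> carrier_mat (n - 1) (n - 1)" by (rule interior_submatrix_carrier[OF A])
  let ?K = "\<forall>v\<in>mat_kernel A. v $ 0 = 0 \<longrightarrow> v = 0\<^sub>v (n + 1)"
  have ones: "ones_vec n \<in> mat_kernel A" "ones_vec n \<noteq> 0\<^sub>v (n + 1)"
    using assms(3) by (auto intro!: mat_kernelI[OF A] simp: ones_vec_def vec_eq_iff)
  have K_det: "?K \<longleftrightarrow> det ?I \<noteq> 0"
    using det_interior_submatrix_iff[OF _ A sym assms(3,4)] assms(1) by simp
  have "mat_rank A = n \<longleftrightarrow> kernel_dim A = 1"
    using rank_plus_kernel_dim[OF A] A by auto
  also have "\<dots> \<longleftrightarrow> ?K"
    unfolding kernel_dim_eq_1_iff[OF A ones] by (rule const_kernel_iff[OF A assms(3)])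
  also have "\<dots> \<longleftrightarrow> mat_rank ?I = n - 1"
    unfolding K_det using vec_space.det_rank_iff[OF I] I by simp
  finally have "mat_rank A = n \<longleftrightarrow> mat_rank ?I = n - 1" .
  moreover have "Polynomial.order 0 (char_poly A) = 1 \<longleftrightarrow> invertible_mat ?I"
    unfolding order_0_char_poly_eq_1_iff[OF A sym assms(3)] K_det invertible_mat_iff_det[OF I] ..
  ultimately show ?thesis ..
qed

end
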